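(* For every even integer $n\geq 10$, there exists a latin square $L$ of order $n$, with rows, columns and symbols indexed by $\mathbb{Z}_n$, such that $L$ has a transversal and there are $\lfloor n/6\rfloor$ entries of $L$ that belong to every suitable diagonal of $L$.
   Context: A latin square of order $n$ indexed by $\mathbb{Z}_n$ is an $n\times n$ array with rows, columns and symbols in $\mathbb{Z}_n$ such that each symbol occurs once in each row and each column; it is viewed as the set of entries $(r,c,s)$ (symbol $s$ in row $r$, column $c$). A transversal is a set of $n$ entries containing each row, each column and each symbol exactly once. For an entry $(r,c,s)$ define $\Delta(r,c,s)$ to be the unique integer with $\Delta(r,c,s)\equiv s-r-c \pmod n$ and $-n/2<\Delta(r,c,s)\le n/2$. For even $n$, a suitable diagonal of $L$ is a set of $n$ entries of $L$, no two in the same row and no two in the same column, such that the sum of their $\Delta$-values is congruent to $n/2$ modulo $n$. *)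

theory Defs
  imports Main
begin

definition latin_square :: "int \<Rightarrow> (int \<times> int \<times> int) set \<Rightarrow> bool" where
  "latin_square n L \<longleftrightarrow>
     L \<subseteq> {0..<n} \<times> {0..<n} \<times> {0..<n} \<and>
     (\<forall>r\<in>{0..<n}. \<forall>c\<in>{0..<n}. \<exists>!s. (r, c, s) \<in> L) \<and>
     (\<forall>r\<in>{0..<n}. \<forall>s\<in>{0..<n}. \<exists>!c. (r, c, s) \<in> L) \<and>
     (\<forall>c\<in>{0..<n}. \<forall>s\<in>{0..<n}. \<exists>!r. (r, c, s) \<in> L)"

definition transversal :: "int \<Rightarrow> (int \<times> int \<times> int) set \<Rightarrow> (int \<times> int \<times> int) set \<Rightarrow> bool" where
  "transversal n L T \<longleftrightarrow> T \<subseteq> L \<and> finite T \<and> card T = nat n \<and>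
     (\<forall>r\<in>{0..<n}. \<exists>!e\<in>T. fst e = r) \<and>
     (\<forall>c\<in>{0..<n}. \<exists>!e\<in>T. fst (snd e) = c) \<and>
     (\<forall>s\<in>{0..<n}. \<exists>!e\<in>T. snd (snd e) = s)"

definition delta :: "int \<Rightarrow> int \<times> int \<times> int \<Rightarrow> int" where
  "delta n e = (case e of (r, c, s) \<Rightarrow>
     (let m = (s - r - c) mod n in if 2 * m \<le> n then m else m - n))"

definition suitable_diagonal :: "int \<Rightarrow> (int \<times> int \<times> int) set \<Rightarrow> (int \<times> int \<times> int) set \<Rightarrow> bool" where
  "suitable_diagonal n L D \<longleftrightarrow> D \<subseteq> L \<and> finite D \<and> card D = nat n \<and>
     (\<forall>e\<in>D. \<forall>e'\<in>D. e \<noteq> e' \<longrightarrow> fst e \<noteq> fst e' \<and> fst (snd e) \<noteq> fst (snd e')) \<and>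
     (\<Sum>e\<in>D. delta n e) mod n = (n div 2) mod n"

end

theory Submission
  imports Defs
begin

text \<open>
  Start from the cyclic square \<open>r + c\<close> and permute, within each column, the entries of small
  groups of neighbouring rows. If \<open>up r\<close> and \<open>lo r\<close> bound the \<open>\<Delta>\<close>-values in row \<open>r\<close>, where
  the \<open>up r\<close> add up to exactly \<open>n div 2\<close> and the \<open>lo r\<close> to more than \<open>- n div 2\<close>, then a
  suitable diagonal must attain the maximum in every row, so each row whose maximum occurs
  only once contributes a forced entry.

  A group of three rows can have maxima adding up to 3 and one row with a unique maximum, so
  about \<open>n div 6\<close> such groups use up the sum \<open>n div 2\<close>. Their minima add up to \<open>- 3\<close>,
  hence one exceptional group of four or five rows is needed to break the symmetry between
  maxima and minima and to account for the residue of \<open>n\<close> modulo 6. The transversal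
  follows the row maxima along arithmetic progressions with step 3 in columns and symbols.
\<close>

section \<open>Squares given by displacements from the cyclic square\<close>

definition shifted_square :: "int \<Rightarrow> (int \<Rightarrow> int \<Rightarrow> int) \<Rightarrow> (int \<times> int \<times> int) set" where
  "shifted_square n d = (\<lambda>(r, c). (r, c, (r + c + d r c) mod n)) ` ({0..<n} \<times> {0..<n})"

lemma mem_shifted_square:
  "(r, c, s) \<in> shifted_square n d \<longleftrightarrow>
     r \<in> {0..<n} \<and> c \<in> {0..<n} \<and> s = (r + c + d r c) mod n"
  by (auto simp: shifted_square_def)

text \<open>An injective self-map of a finite set is onto. This reduces the unique-existence clauses
  for latin squares and transversals to injectivity.\<close>

lemma inj_on_interval_unique_preimage:
  fixes f :: "int \<Rightarrow> int"
  assumes "inj_on f {0..<n}" "f ` {0..<n} \<subseteq> {0..<n}" "s \<in> {0..<n}"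
  shows "\<exists>!x. x \<in> {0..<n} \<and> f x = s"
proof -
  have "f ` {0..<n} = {0..<n}"
    using assms by (simp add: endo_inj_surj)
  with assms(3) have "s \<in> f ` {0..<n}" by (simp only:)
  then obtain x where x: "x \<in> {0..<n}" "f x = s"
    by (auto simp only:)
  show ?thesis
  proof (rule ex1I)
    show "x \<in> {0..<n} \<and> f x = s" using x by blast
    show "y = x" if "y \<in> {0..<n} \<and> f y = s" for y
      using inj_onD[OF assms(1), of y x] that x by simp
  qed
qed

lemma ex1_image:
  assumes "\<exists>!x. x \<in> A \<and> h (f x) = c"
  shows "\<exists>!e. e \<in> f ` A \<and> h e = c"
  using assms by blast

lemma latin_square_shifted_square:
  assumes "0 < n"
    and row: "\<And>r. r \<in> {0..<n} \<Longrightarrow> inj_on (\<lambda>c. (r + c + d r c) mod n) {0..<n}"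
    and col: "\<And>c. c \<in> {0..<n} \<Longrightarrow> inj_on (\<lambda>r. (r + c + d r c) mod n) {0..<n}"
  shows "latin_square n (shifted_square n d)"
  unfolding latin_square_def
proof (intro conjI ballI)
  show "shifted_square n d \<subseteq> {0..<n} \<times> {0..<n} \<times> {0..<n}"
    using \<open>0 < n\<close> by (auto simp: shifted_square_def)
  fix a b assume ab: "a \<in> {0..<n}" "b \<in> {0..<n}"
  show "\<exists>!s. (a, b, s) \<in> shifted_square n d"
    using ab by (simp add: mem_shifted_square)
  have "\<exists>!c. c \<in> {0..<n} \<and> (a + c + d a c) mod n = b"
    by (rule inj_on_interval_unique_preimage[OF row]) (use ab \<open>0 < n\<close> in auto)
  moreover have "(a, c, b) \<in> shifted_square n d \<longleftrightarrow> c \<in> {0..<n} \<and> (a + c + d a c) mod n = b" for c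
    using ab unfolding mem_shifted_square by blast
  ultimately show "\<exists>!c. (a, c, b) \<in> shifted_square n d"
    by (simp only:)
  have "\<exists>!r. r \<in> {0..<n} \<and> (r + a + d r a) mod n = b"
    by (rule inj_on_interval_unique_preimage[OF col]) (use ab \<open>0 < n\<close> in auto)
  moreover have "(r, a, b) \<in> shifted_square n d \<longleftrightarrow> r \<in> {0..<n} \<and> (r + a + d r a) mod n = b" for r
    using ab unfolding mem_shifted_square by blast
  ultimately show "\<exists>!r. (r, a, b) \<in> shifted_square n d"
    by (simp only:)
qed

text \<open>As long as a displacement stays in the window \<open>(-n/2, n/2]\<close>, it is the
  representative that \<open>delta\<close> selects, so no reduction takes place.\<close>

lemma delta_shifted:
  assumes "- n < 2 * d" "2 * d \<le> n" "0 < n"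
  shows "delta n (r, c, (r + c + d) mod n) = d"
proof -
  have "((r + c + d) mod n - r - c) mod n = d mod n"
    by (simp add: mod_simps diff_diff_eq)
  moreover have "d mod n = (if 0 \<le> d then d else d + n)"
  proof (cases "0 \<le> d")
    case True
    then show ?thesis using assms by (simp add: mod_pos_pos_trivial)
  next
    case False
    then have "(d + n) mod n = d + n"
      using assms by (intro mod_pos_pos_trivial) auto
    then show ?thesis using False by simp
  qed
  ultimately show ?thesis
    using assms by (auto simp: delta_def Let_def)
qed

lemma transversal_shifted_square:
  assumes "0 < n"
    and t: "\<And>r. r \<in> {0..<n} \<Longrightarrow> t r \<in> {0..<n}" "inj_on t {0..<n}"
    and sym: "inj_on (\<lambda>r. (r + t r + d r (t r)) mod n) {0..<n}"
  shows "transversal n (shifted_square n d)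
    ((\<lambda>r. (r, t r, (r + t r + d r (t r)) mod n)) ` {0..<n})"
    (is "transversal n _ (?e ` _)")
proof -
  have "inj_on ?e {0..<n}"
    by (auto simp: inj_on_def)
  then have "card (?e ` {0..<n}) = nat n"
    by (simp add: card_image)
  moreover have "\<exists>!e. e \<in> ?e ` {0..<n} \<and> fst e = r" if "r \<in> {0..<n}" for r
    by (rule ex1_image) (use that in auto)
  moreover have "\<exists>!e. e \<in> ?e ` {0..<n} \<and> fst (snd e) = c" if "c \<in> {0..<n}" for c
  proof -
    have "\<exists>!r. r \<in> {0..<n} \<and> t r = c"
      by (rule inj_on_interval_unique_preimage[OF t(2) _ that]) (use t(1) in blast)
    then show ?thesis by - (rule ex1_image, simp)
  qed
  moreover have "\<exists>!e. e \<in> ?e ` {0..<n} \<and> snd (snd e) = s" if "s \<in> {0..<n}" for s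
  proof -
    have "\<exists>!r. r \<in> {0..<n} \<and> (r + t r + d r (t r)) mod n = s"
      by (rule inj_on_interval_unique_preimage) (use that sym \<open>0 < n\<close> in auto)
    then show ?thesis by - (rule ex1_image, simp)
  qed
  ultimately show ?thesis
    using t(1) by (auto simp: transversal_def mem_shifted_square)
qed

text \<open>The bounds confine the sum over a diagonal to \<open>(-n/2, n/2]\<close>, where only
  \<open>n div 2\<close> has the required residue. This is also the sum of the upper bounds, so no
  row can fall below its own bound.\<close>

lemma suitable_diagonal_forced:
  assumes "0 < n" "even n"
    and bound: "\<And>r c. r \<in> {0..<n} \<Longrightarrow> c \<in> {0..<n} \<Longrightarrow> lo r \<le> d r c \<and> d r c \<le> up r"
    and small: "\<And>r. r \<in> {0..<n} \<Longrightarrow> - n < 2 * lo r \<and> 2 * up r \<le> n"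
    and sum_up: "(\<Sum>r\<in>{0..<n}. up r) = n div 2"
    and sum_lo: "- (n div 2) < (\<Sum>r\<in>{0..<n}. lo r)"
    and D: "suitable_diagonal n (shifted_square n d) D"
    and r: "r \<in> {0..<n}"
  shows "\<exists>c\<in>{0..<n}. d r c = up r \<and> (r, c, (r + c + d r c) mod n) \<in> D"
proof -
  let ?R = "{0..<n}"
  have DL: "D \<subseteq> shifted_square n d" and "finite D" and cardD: "card D = nat n"
    and inj: "inj_on fst D"
    and sum_D: "(\<Sum>e\<in>D. delta n e) mod n = (n div 2) mod n"
    using D by (auto simp: suitable_diagonal_def inj_on_def)
  \<comment> \<open>A diagonal has \<open>n\<close> entries in distinct rows, so it meets every row,
    and sums over \<open>D\<close> of functions of the row become sums over all rows.\<close>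
  have rows: "fst ` D = ?R"
  proof (rule card_subset_eq)
    show "fst ` D \<subseteq> ?R"
      using DL by (auto simp: shifted_square_def)
    show "card (fst ` D) = card ?R"
      using inj cardD by (simp add: card_image)
  qed simp
  have delta_e: "delta n e = d (fst e) (fst (snd e))"
    and mem_e: "fst e \<in> ?R" "fst (snd e) \<in> ?R"
    and form_e: "e = (fst e, fst (snd e), (fst e + fst (snd e) + d (fst e) (fst (snd e))) mod n)"
    if "e \<in> D" for e
  proof -
    obtain a b s where e: "e = (a, b, s)" by (cases e)
    have ab: "a \<in> ?R" "b \<in> ?R" "s = (a + b + d a b) mod n"
      using that DL e by (auto simp: mem_shifted_square)
    show "fst e \<in> ?R" "fst (snd e) \<in> ?R" using ab e by auto
    show "e = (fst e, fst (snd e), (fst e + fst (snd e) + d (fst e) (fst (snd e))) mod n)"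
      using ab e by simp
    have "lo a \<le> d a b" "d a b \<le> up a" "- n < 2 * lo a" "2 * up a \<le> n"
      using bound small ab by blast+
    then show "delta n e = d (fst e) (fst (snd e))"
      using ab e \<open>0 < n\<close> by (simp add: delta_shifted)
  qed
  have sum_rows: "(\<Sum>e\<in>D. h (fst e)) = (\<Sum>r\<in>?R. h r)" for h :: "int \<Rightarrow> int"
    using sum.reindex[OF inj, of h] rows by simp
  have le: "delta n e \<le> up (fst e)" "lo (fst e) \<le> delta n e" if "e \<in> D" for e
    using bound mem_e[OF that] delta_e[OF that] by auto
  have "(\<Sum>e\<in>D. delta n e) \<le> n div 2"
    using sum_mono[of D "delta n" "\<lambda>e. up (fst e)"] le sum_rows[of up] sum_up by simp
  moreover have "- (n div 2) < (\<Sum>e\<in>D. delta n e)"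
    using sum_mono[of D "\<lambda>e. lo (fst e)" "delta n"] le sum_rows[of lo] sum_lo by simp
  moreover have "n dvd n div 2 - (\<Sum>e\<in>D. delta n e)"
    using sum_D[symmetric] by (simp only: mod_eq_dvd_iff)
  moreover have "n div 2 + n div 2 = n"
    using \<open>even n\<close> by simp
  \<comment> \<open>The difference from \<open>n div 2\<close> is a multiple of \<open>n\<close> in
    \<open>[0, n)\<close>, hence zero.\<close>
  ultimately have "(\<Sum>e\<in>D. delta n e) = n div 2"
    using zdvd_not_zless[of "n div 2 - (\<Sum>e\<in>D. delta n e)" n] by linarith
  then have "(\<Sum>e\<in>D. up (fst e) - delta n e) = 0"
    using sum_rows[of up] sum_up by (simp add: sum_subtractf)
  then have max: "up (fst e) = delta n e" if "e \<in> D" for e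
    using sum_nonneg_eq_0_iff[OF \<open>finite D\<close>, of "\<lambda>e. up (fst e) - delta n e"] le(1) that by auto
  obtain e where e: "e \<in> D" "fst e = r"
    using rows r by (metis imageE)
  show ?thesis
  proof (intro bexI conjI)
    show "fst (snd e) \<in> ?R" using mem_e e by blast
    show "d r (fst (snd e)) = up r" using max delta_e e by metis
    show "(r, fst (snd e), (r + fst (snd e) + d r (fst (snd e))) mod n) \<in> D"
      using form_e e by metis
  qed
qed

text \<open>For even \<open>n\<close> a transversal has \<open>delta\<close>-sum congruent to
  \<open>n div 2\<close>, so it is itself a suitable diagonal and must follow the row maxima. Hence
  one function \<open>t\<close> describes both the transversal and, on the rows \<open>K\<close>
  with a unique maximum, the forced entries.\<close>

lemma shifted_square_forced_entries:
  assumes "0 < n" "even n"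
    and row: "\<And>r. r \<in> {0..<n} \<Longrightarrow> inj_on (\<lambda>c. (r + c + d r c) mod n) {0..<n}"
    and col: "\<And>c. c \<in> {0..<n} \<Longrightarrow> inj_on (\<lambda>r. (r + c + d r c) mod n) {0..<n}"
    and bound: "\<And>r c. r \<in> {0..<n} \<Longrightarrow> c \<in> {0..<n} \<Longrightarrow> lo r \<le> d r c \<and> d r c \<le> up r"
    and small: "\<And>r. r \<in> {0..<n} \<Longrightarrow> - n < 2 * lo r \<and> 2 * up r \<le> n"
    and sum_up: "(\<Sum>r\<in>{0..<n}. up r) = n div 2"
    and sum_lo: "- (n div 2) < (\<Sum>r\<in>{0..<n}. lo r)"
    and t: "\<And>r. r \<in> {0..<n} \<Longrightarrow> t r \<in> {0..<n}" "inj_on t {0..<n}"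
      "\<And>r. r \<in> {0..<n} \<Longrightarrow> d r (t r) = up r"
    and sym: "inj_on (\<lambda>r. (r + t r + d r (t r)) mod n) {0..<n}"
    and K: "K \<subseteq> {0..<n}"
      "\<And>r c. r \<in> K \<Longrightarrow> c \<in> {0..<n} \<Longrightarrow> d r c = up r \<Longrightarrow> c = t r"
  shows "\<exists>L. latin_square n L \<and> (\<exists>T. transversal n L T) \<and>
           (\<exists>E. E \<subseteq> L \<and> card E = card K \<and>
                (\<forall>D. suitable_diagonal n L D \<longrightarrow> E \<subseteq> D))"
proof (intro exI conjI allI impI)
  let ?L = "shifted_square n d"
  let ?E = "(\<lambda>r. (r, t r, (r + t r + d r (t r)) mod n)) ` K"
  show "latin_square n ?L"
    by (rule latin_square_shifted_square) fact+
  show "transversal n ?L ((\<lambda>r. (r, t r, (r + t r + d r (t r)) mod n)) ` {0..<n})"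
    by (rule transversal_shifted_square) fact+
  show "?E \<subseteq> ?L"
    using K(1) t(1) by (auto simp: mem_shifted_square)
  show "card ?E = card K"
    by (rule card_image) (auto simp: inj_on_def)
  show "?E \<subseteq> D" if D: "suitable_diagonal n ?L D" for D
  proof
    fix x assume "x \<in> ?E"
    then obtain r where r: "r \<in> K" "x = (r, t r, (r + t r + d r (t r)) mod n)" by blast
    then have rn: "r \<in> {0..<n}" using K(1) by blast
    have "\<exists>c\<in>{0..<n}. d r c = up r \<and> (r, c, (r + c + d r c) mod n) \<in> D"
      by (rule suitable_diagonal_forced) fact+
    with K(2) r show "x \<in> D" by blast
  qed
qed

section \<open>Six-row blocks, special rows and the columns of the transversal\<close>

text \<open>Entry \<open>block i y\<close> tells which of the rows \<open>6 * j + {0..5}\<close> of the cyclic square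
  supplies the symbol in row \<open>6 * j + i\<close>, at distance \<open>y\<close> from a column chosen for the
  block. Row 0 takes the symbol of row 2 only at \<open>y = 0\<close>; this is the forced entry.\<close>

definition block :: "int \<Rightarrow> int \<Rightarrow> int" where
  "block i y =
    (if i = 0 then (if y = 0 then 2 else if y = 1 then 0 else 1)
     else if i = 1 then (if y = 0 \<or> y = 1 then 1 else if even y then 2 else 0)
     else if i = 2 then (if even y then 0 else 2)
     else i)"

text \<open>Rows below \<open>6 * q\<close> carry the blocks; \<open>\<sigma> k x\<close> plays the role of \<open>block\<close> for the
  remaining rows \<open>6 * q + k\<close>, with columns counted from \<open>3 * q\<close>.\<close>

definition displacement :: "int \<Rightarrow> int \<Rightarrow> (int \<Rightarrow> int \<Rightarrow> int) \<Rightarrow> int \<Rightarrow> int \<Rightarrow> int" where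
  "displacement q g \<sigma> r c =
    (if r < 6 * q then block (r mod 6) (c - (6 * q + g - 3 - 3 * (r div 6))) - r mod 6
     else \<sigma> (r - 6 * q) (c - 3 * q) - (r - 6 * q))"

text \<open>The columns \<open>{0..<n}\<close> are cut, in this order, into intervals of length \<open>3 * q\<close>, \<open>g\<close>,
  \<open>3 * q\<close> and \<open>g - 2\<close>: the transversal meets the unchanged rows in the first one, the
  three-row blocks in the third one and the last \<open>2 * g - 2\<close> rows in the other two.\<close>

abbreviation "offset i \<equiv> (if i = 1 \<or> i = (4::int) then 2 else if i = 2 \<or> i = 3 then 1 else (0::int))"

definition transversal_column :: "int \<Rightarrow> int \<Rightarrow> (int \<Rightarrow> int) \<Rightarrow> int \<Rightarrow> int" where
  "transversal_column q g \<tau> r =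
    (if r < 6 * q then
       (if r mod 6 < 3 then 6 * q + g - 3 else 3 * q - 3) - 3 * (r div 6) + offset (r mod 6)
     else \<tau> (r - 6 * q))"

text \<open>Here \<open>h\<close> bounds the displacement itself, while \<open>b\<close> bounds the
  index of the supplying row, from which the row's own index is subtracted.\<close>

definition row_bound :: "int \<Rightarrow> (int \<Rightarrow> int) \<Rightarrow> (int \<Rightarrow> int) \<Rightarrow> int \<Rightarrow> int" where
  "row_bound q h b r = (if r < 6 * q then h (r mod 6) else b (r - 6 * q) - (r - 6 * q))"

text \<open>The extreme values of \<open>block i y - i\<close>; over a block they add up to 3 and,
  in \<open>block_lo\<close>, to -3.\<close>

abbreviation "block_up i \<equiv> (if i = 0 then 2 else if i = 1 then 1 else (0::int))"
abbreviation "block_lo i \<equiv> (if i = (1::int) then - 1 else if i = 2 then - 2 else (0::int))"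

section \<open>Injectivity modulo \<open>n\<close> within a row, and sums of the row bounds\<close>

lemma int_mod_6_cases:
  "r mod 6 \<in> {0, 1, 2, 3, 4, 5}" for r :: int
  by simp presburger

lemma eq_if_mod_eq:
  fixes a b n :: int
  assumes "a mod n = b mod n" "l \<le> a" "a < l + n" "l \<le> b" "b < l + n"
  shows "a = b"
proof -
  have "(a - l) mod n = (b - l) mod n"
    using assms(1) by (rule mod_diff_cong) simp
  with assms(2-) show ?thesis
    by (simp add: mod_pos_pos_trivial)
qed

text \<open>A collision modulo \<open>n\<close> means that the two values differ by 0 or by
  \<open>n\<close>. As \<open>p\<close> stays in \<open>[0, m]\<close>, the arguments are then at
  distance at most \<open>m\<close>, either directly (\<open>step\<close>) or across the end of the
  window (\<open>wrap\<close>), so boundedly many distances have to be checked.\<close>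

lemma inj_on_add_mod:
  fixes n l m :: int
  assumes "m < n"
    and p: "\<And>x. 0 \<le> p x \<and> p x \<le> m"
    and step: "\<And>x d. d \<in> {1..m} \<Longrightarrow> p x \<noteq> p (x + d) + d"
    and wrap: "\<And>j d. d \<in> {1..m} \<Longrightarrow> j \<in> {0..<d} \<Longrightarrow> p (l + n + j - d) \<noteq> p (l + j) + d"
  shows "inj_on (\<lambda>x. (x + p x) mod n) {l..<l + n}"
proof (rule linorder_inj_onI)
  fix x y assume "x < y" and x: "x \<in> {l..<l + n}" and y: "y \<in> {l..<l + n}"
  show "(x + p x) mod n \<noteq> (y + p y) mod n"
  proof
    assume "(x + p x) mod n = (y + p y) mod n"
    then have "n dvd (y + p y) - (x + p x)"
      by (metis mod_eq_dvd_iff)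
    then obtain k where k: "(y + p y) - (x + p x) = n * k" by blast
    have "n * (- 1) < n * k" "n * k < n * 2"
      unfolding k[symmetric] using \<open>x < y\<close> \<open>m < n\<close> x y p[of x] p[of y] by auto
    moreover have "0 < n"
      using p[of x] \<open>m < n\<close> by linarith
    ultimately have "- 1 < k \<and> k < 2"
      by (simp only: mult_less_cancel_left_pos)
    then consider "k = 0" | "k = 1"
      by linarith
    then show False
    proof cases
      case 1
      then have "p x = p y + (y - x)" "y - x \<in> {1..m}"
        using k \<open>x < y\<close> p[of x] p[of y] by auto
      then show False
        using step[of "y - x" x] by simp
    next
      case 2
      then have "p y = p x + (x + n - y)" "x + n - y \<in> {1..m}" "x - l \<in> {0..<x + n - y}"
        using k x y p[of x] p[of y] by auto
      then show False
        using wrap[of "x + n - y" "x - l"] by simp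
    qed
  qed
qed (simp add: linear)

text \<open>With \<open>x = c - b\<close> the symbols differ from \<open>x + p x\<close> by the
  constant \<open>a + b - k\<close>, so each pattern can be studied in its own coordinate.\<close>

lemma inj_on_shift_mod:
  fixes n a b :: int
  assumes "inj_on (\<lambda>x. (x + p x) mod n) {- b..<n - b}"
  shows "inj_on (\<lambda>c. (a + c + (p (c - b) - k)) mod n) {0..<n}"
proof (rule inj_onI)
  fix x y assume xy: "x \<in> {0..<n}" "y \<in> {0..<n}"
    and "(a + x + (p (x - b) - k)) mod n = (a + y + (p (y - b) - k)) mod n"
  then have "(a + x + (p (x - b) - k) - (a + b - k)) mod n = (a + y + (p (y - b) - k) - (a + b - k)) mod n"
    by (metis mod_diff_cong)
  then have "((x - b) + p (x - b)) mod n = ((y - b) + p (y - b)) mod n"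
    by (simp add: algebra_simps)
  then have "x - b = y - b"
    using inj_onD[OF assms, of "x - b" "y - b"] xy by simp
  then show "x = y" by simp
qed

text \<open>Away from \<open>y = 0\<close> and \<open>y = 1\<close> the rows 0 to 2 have period 2,
  so evenness of \<open>n\<close> lets them close up across the end of the window; the conditions on
  \<open>b\<close> place these two columns inside it. The rows 3 to 5 are plain
  translations.\<close>

lemma inj_on_block_row:
  assumes i: "i \<in> {0, 1, 2, 3, 4, 5}" and "even n" "6 \<le> n" "0 \<le> b" "b + 2 < n"
  shows "inj_on (\<lambda>x. (x + block i x) mod n) {- b..<n - b}"
proof (cases "i < 3")
  case True
  then have i': "i \<in> {0, 1, 2}" using i by auto
  have "inj_on (\<lambda>x. (x + block i x) mod n) {- b..<- b + n}"
  proof (rule inj_on_add_mod[of 2])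
    show "2 < n" using assms by simp
    show "0 \<le> block i x \<and> block i x \<le> 2" for x
      using i' by (auto simp: block_def)
    fix d :: int assume "d \<in> {1..2}"
    then have d: "d = 1 \<or> d = 2" by auto
    then show "block i x \<noteq> block i (x + d) + d" for x
      using i' by (auto simp: block_def; presburger)
    fix j assume "j \<in> {0..<d}"
    with d have "j = 0 \<and> d = 1 \<or> j = 0 \<and> d = 2 \<or> j = 1 \<and> d = 2" by auto
    then show "block i (- b + n + j - d) \<noteq> block i (- b + j) + d"
      using i' assms(2-) by (elim insertE disjE conjE emptyE) (simp_all add: block_def)
  qed
  then show ?thesis by simp
next
  case False
  then show ?thesis
    using i assms(3) inj_on_add_mod[of i n "\<lambda>_. i" "- b"] by (auto simp: block_def)
qed

lemma sum_mod_6: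
  fixes h :: "int \<Rightarrow> int"
  assumes "0 \<le> q"
  shows "(\<Sum>r\<in>{0..<6 * q}. h (r mod 6)) = q * (h 0 + h 1 + h 2 + h 3 + h 4 + h 5)"
  using assms
proof (induction q rule: int_ge_induct)
  case base
  show ?case by simp
next
  case (step q)
  let ?B = "{6 * q, 6 * q + 1, 6 * q + 2, 6 * q + 3, 6 * q + 4, 6 * q + 5}"
  have "{0..<6 * (q + 1)} = {0..<6 * q} \<union> ?B"
    using step.hyps by auto
  then have "(\<Sum>r\<in>{0..<6 * (q + 1)}. h (r mod 6)) =
      (\<Sum>r\<in>{0..<6 * q}. h (r mod 6)) + (\<Sum>r\<in>?B. h (r mod 6))"
    using sum.union_disjoint[of "{0..<6 * q}" ?B "\<lambda>r. h (r mod 6)"] by simp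
  also have "(\<Sum>r\<in>?B. h (r mod 6)) = h 0 + h 1 + h 2 + h 3 + h 4 + h 5"
    by simp
  finally show ?case
    using step.IH by (simp add: algebra_simps)
qed

lemma sum_row_bound:
  assumes "0 \<le> q" "0 \<le> e"
  shows "(\<Sum>r\<in>{0..<6 * q + e}. row_bound q h b r) =
    q * (h 0 + h 1 + h 2 + h 3 + h 4 + h 5) + (\<Sum>k\<in>{0..<e}. b k - k)"
proof -
  have "{0..<6 * q + e} = {0..<6 * q} \<union> {6 * q..<6 * q + e}"
    using assms by auto
  then have "(\<Sum>r\<in>{0..<6 * q + e}. row_bound q h b r) =
      (\<Sum>r\<in>{0..<6 * q}. row_bound q h b r) + (\<Sum>r\<in>{6 * q..<6 * q + e}. row_bound q h b r)"
    by (simp add: sum.union_disjoint)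
  also have "(\<Sum>r\<in>{0..<6 * q}. row_bound q h b r) = (\<Sum>r\<in>{0..<6 * q}. h (r mod 6))"
    by (rule sum.cong) (auto simp: row_bound_def)
  also have "(\<Sum>r\<in>{6 * q..<6 * q + e}. row_bound q h b r) = (\<Sum>k\<in>{0..<e}. b k - k)"
    by (rule sum.reindex_bij_witness[of _ "\<lambda>k. k + 6 * q" "\<lambda>r. r - 6 * q"])
      (auto simp: row_bound_def)
  finally show ?thesis
    using sum_mod_6[OF assms(1)] by simp
qed

lemma block_range: "i \<in> {0, 1, 2, 3, 4, 5} \<Longrightarrow> block i y \<in> {0, 1, 2, 3, 4, 5}"
  by (auto simp: block_def)

lemma block_inj:
  assumes "block i y = block i' y" "i \<in> {0, 1, 2, 3, 4, 5}" "i' \<in> {0, 1, 2, 3, 4, 5}"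
  shows "i = i'"
  using assms by (auto simp: block_def split: if_splits)

section \<open>The latin property of the combined square\<close>

lemma inj_on_displacement_row:
  assumes "even n" "6 \<le> g" "n = 6 * q + (2 * g - 2)"
    and \<sigma>: "\<And>k. k \<in> {0..<2 * g - 2} \<Longrightarrow> inj_on (\<lambda>x. (x + \<sigma> k x) mod n) {- (3 * q)..<n - 3 * q}"
    and r: "r \<in> {0..<n}"
  shows "inj_on (\<lambda>c. (r + c + displacement q g \<sigma> r c) mod n) {0..<n}"
proof (cases "r < 6 * q")
  case True
  let ?b = "6 * q + g - 3 - 3 * (r div 6)"
  have b: "0 \<le> ?b" "?b + 2 < n"
    using True r assms(2,3) by auto
  show ?thesis
    using inj_on_shift_mod[OF inj_on_block_row[OF int_mod_6_cases \<open>even n\<close> _ b]] True r assms(2,3)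
    by (simp add: displacement_def)
next
  case False
  then have "r - 6 * q \<in> {0..<2 * g - 2}"
    using r assms(3) by simp
  from inj_on_shift_mod[OF \<sigma>[OF this], of r "r - 6 * q"] False show ?thesis
    by (simp add: displacement_def)
qed

text \<open>Within a column the supplying rows permute each block of six and permute the special
  rows, so altogether they permute \<open>{0..<n}\<close>.\<close>

lemma inj_on_displacement_col:
  assumes "0 \<le> q" "0 \<le> e" "n = 6 * q + e"
    and \<sigma>: "\<And>k. k \<in> {0..<e} \<Longrightarrow> \<sigma> k (c - 3 * q) \<in> {0..<e}"
      "inj_on (\<lambda>k. \<sigma> k (c - 3 * q)) {0..<e}"
  shows "inj_on (\<lambda>r. (r + c + displacement q g \<sigma> r c) mod n) {0..<n}"
proof (rule inj_onI)
  \<comment> \<open>\<open>f r\<close> is the row of the cyclic square whose symbol is placed in row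
    \<open>r\<close>.\<close>
  define f where "f r = r + displacement q g \<sigma> r c" for r
  have low: "f r div 6 = r div 6 \<and> f r mod 6 = block (r mod 6) (c - (6 * q + g - 3 - 3 * (r div 6)))
      \<and> 0 \<le> f r \<and> f r < 6 * q" if "0 \<le> r" "r < 6 * q" for r
  proof -
    let ?p = "block (r mod 6) (c - (6 * q + g - 3 - 3 * (r div 6)))"
    have "f r = 6 * (r div 6) + ?p"
      using that by (simp add: f_def displacement_def minus_mod_eq_mult_div)
    moreover have "0 \<le> ?p \<and> ?p < 6"
      using block_range[OF int_mod_6_cases[of r], of "c - (6 * q + g - 3 - 3 * (r div 6))"] by auto
    moreover have "r div 6 < q" "0 \<le> r div 6"
      using that by auto
    ultimately show ?thesis
      by auto
  qed
  have high: "f r = \<sigma> (r - 6 * q) (c - 3 * q) + 6 * q \<and> f r \<in> {6 * q..<n}"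
    if "6 * q \<le> r" "r < n" for r
    using that \<sigma>(1)[of "r - 6 * q"] assms(3) by (simp add: f_def displacement_def)
  fix r r' assume r: "r \<in> {0..<n}" "r' \<in> {0..<n}"
    and eq: "(r + c + displacement q g \<sigma> r c) mod n = (r' + c + displacement q g \<sigma> r' c) mod n"
  have rng: "0 \<le> f x \<and> f x < n" if "x \<in> {0..<n}" for x
    using low[of x] high[of x] that assms(1-3) by (cases "x < 6 * q") auto
  have "(c + f r) mod n = (c + f r') mod n"
    using eq by (simp add: f_def algebra_simps)
  then have "c + f r = c + f r'"
    by (rule eq_if_mod_eq[of _ _ _ c]) (use rng r in auto)
  then have f: "f r = f r'" by simp
  show "r = r'"
  proof (cases "r < 6 * q")
    case True
    have "r' < 6 * q"
      by (rule ccontr) (use True low[of r] high[of r'] f r in auto)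
    with True low[of r] low[of r'] f r have div: "r div 6 = r' div 6"
      and "block (r mod 6) (c - (6 * q + g - 3 - 3 * (r div 6)))
        = block (r' mod 6) (c - (6 * q + g - 3 - 3 * (r div 6)))" by auto
    then have "r mod 6 = r' mod 6"
      using block_inj int_mod_6_cases by blast
    with div show ?thesis
      by (metis div_mult_mod_eq)
  next
    case False
    have "6 * q \<le> r'"
      by (rule ccontr) (use False low[of r'] high[of r] f r in auto)
    with False high[of r] high[of r'] f r
    have "\<sigma> (r - 6 * q) (c - 3 * q) = \<sigma> (r' - 6 * q) (c - 3 * q)" by auto
    with inj_onD[OF \<sigma>(2), of "r - 6 * q" "r' - 6 * q"] False \<open>6 * q \<le> r'\<close> r assms(3)
    show ?thesis by simp
  qed
qed

section \<open>The transversal through the row maxima\<close>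

lemma div_3_unique:
  fixes a b u v :: int
  assumes "3 * a + u = 3 * b + v" "u \<in> {0, 1, 2}" "v \<in> {0, 1, 2}"
  shows "a = b \<and> u = v"
  using assms by auto presburger+

lemma transversal_column_block:
  assumes "r < 6 * q"
  shows "transversal_column q g \<tau> r =
    (if r mod 6 < 3 then 6 * q + g - 3 else 3 * q - 3) - 3 * (r div 6) + offset (r mod 6)"
  using assms by (simp add: transversal_column_def)

lemma transversal_column_special: "6 * q \<le> r \<Longrightarrow> transversal_column q g \<tau> r = \<tau> (r - 6 * q)"
  by (simp add: transversal_column_def)

text \<open>In a block the offsets 0, 2, 1 of the rows 0, 1, 2 are positions \<open>y\<close> at
  which these rows take the symbol of row 2, the largest available; the rows 3 to 5 have
  displacement 0 everywhere.\<close>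

lemma displacement_transversal_column:
  assumes "r \<in> {0..<6 * q + e}"
    and "\<And>k. k \<in> {0..<e} \<Longrightarrow> \<sigma> k (\<tau> k - 3 * q) = up k"
  shows "displacement q g \<sigma> r (transversal_column q g \<tau> r) = row_bound q block_up up r"
proof (cases "r < 6 * q")
  case True
  then show ?thesis
    using int_mod_6_cases[of r] by (auto simp: transversal_column_block displacement_def row_bound_def block_def)
next
  case False
  then show ?thesis
    using assms by (simp add: transversal_column_special displacement_def row_bound_def)
qed

text \<open>Each group of three rows takes three consecutive columns, and successive groups descend
  by 3. The groups thus stay in \<open>{0..<3 * q}\<close> and
  \<open>{3 * q + g..<6 * q + g}\<close>, away from the columns of the special rows.\<close>

lemma transversal_column_bij:
  assumes "0 \<le> q" "6 \<le> g" "n = 6 * q + (2 * g - 2)"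
    and \<tau>: "\<And>k. k \<in> {0..<2 * g - 2} \<Longrightarrow> \<tau> k \<in> {3 * q..<3 * q + g} \<union> {6 * q + g..<n}"
      "inj_on \<tau> {0..<2 * g - 2}"
  shows "inj_on (transversal_column q g \<tau>) {0..<n}" and "\<And>r. r \<in> {0..<n} \<Longrightarrow> transversal_column q g \<tau> r \<in> {0..<n}"
proof -
  have low: "transversal_column q g \<tau> r \<in> (if r mod 6 < 3 then {3 * q + g..<6 * q + g} else {0..<3 * q})"
    if "0 \<le> r" "r < 6 * q" for r
  proof -
    have "0 \<le> r div 6" "r div 6 < q" using that by auto
    then show ?thesis using that assms(1,2) by (auto simp: transversal_column_block)
  qed
  have high: "transversal_column q g \<tau> r = \<tau> (r - 6 * q) \<and> r - 6 * q \<in> {0..<2 * g - 2} \<and>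
      transversal_column q g \<tau> r \<in> {3 * q..<3 * q + g} \<union> {6 * q + g..<n}"
    if "6 * q \<le> r" "r < n" for r
    using \<tau>(1)[of "r - 6 * q"] that assms(3) by (simp add: transversal_column_special)
  show "transversal_column q g \<tau> r \<in> {0..<n}" if "r \<in> {0..<n}" for r
    using low[of r] high[of r] that assms(1-3) by (cases "r < 6 * q") (auto split: if_splits)
  show "inj_on (transversal_column q g \<tau>) {0..<n}"
  proof (rule inj_onI)
    fix r r' assume r: "r \<in> {0..<n}" "r' \<in> {0..<n}" and eq: "transversal_column q g \<tau> r = transversal_column q g \<tau> r'"
    show "r = r'"
    proof (cases "r < 6 * q")
      case True
      have "r' < 6 * q"
        by (rule ccontr) (use True low[of r] high[of r'] eq r assms(1-3) in \<open>auto split: if_splits\<close>)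
      have third: "r mod 6 < 3 \<longleftrightarrow> r' mod 6 < 3"
        using low[of r] low[of r'] True \<open>r' < 6 * q\<close> eq r assms(1,2) by (auto split: if_splits)
      have "3 * (r' div 6) + offset (r mod 6) = 3 * (r div 6) + offset (r' mod 6)"
        using eq third True \<open>r' < 6 * q\<close> by (simp only: transversal_column_block)
      then have "r' div 6 = r div 6 \<and> offset (r mod 6) = offset (r' mod 6)"
        by (rule div_3_unique) auto
      moreover from this third have "r mod 6 = r' mod 6"
        using int_mod_6_cases[of r] int_mod_6_cases[of r'] by auto
      ultimately show ?thesis
        by (metis div_mult_mod_eq)
    next
      case False
      have "6 * q \<le> r'"
        by (rule ccontr) (use False low[of r'] high[of r] eq r assms(1-3) in \<open>auto split: if_splits\<close>)
      have "r - 6 * q = r' - 6 * q"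
      proof (rule inj_onD[OF \<tau>(2)])
        show "\<tau> (r - 6 * q) = \<tau> (r' - 6 * q)"
          using False \<open>6 * q \<le> r'\<close> eq by (simp add: transversal_column_special)
      qed (use False \<open>6 * q \<le> r'\<close> r assms(3) in auto)
      then show ?thesis by simp
    qed
  qed
qed

text \<open>From one block to the next rows grow by 6 and columns drop by 3, so symbols grow by 3,
  and each group of three rows has three consecutive symbols. The special rows fit into the two
  remaining intervals of symbols.\<close>

lemma transversal_column_symbols:
  assumes "0 \<le> q" "6 \<le> g" "n = 6 * q + (2 * g - 2)"
    and \<tau>: "\<And>k. k \<in> {0..<2 * g - 2} \<Longrightarrow> \<tau> k + up k \<in> {3 * q + g - 1..<3 * q + 2 * g - 1} \<union> {n + 1..<n + g - 1}"
      "inj_on (\<lambda>k. \<tau> k + up k) {0..<2 * g - 2}"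
  shows "inj_on (\<lambda>r. (r + transversal_column q g \<tau> r + row_bound q block_up up r) mod n) {0..<n}"
proof (rule inj_onI)
  define S where "S r = r + transversal_column q g \<tau> r + row_bound q block_up up r" for r
  \<comment> \<open>\<open>S\<close> is the unreduced symbol; \<open>S'\<close> moves it into the
    window of length \<open>n\<close> starting at \<open>3 * q + 1\<close>, where congruence is
    equality.\<close>
  define S' where "S' r = (if S r < 3 * q + 1 + n then S r else S r - n)" for r
  \<comment> \<open>Position of the symbol within its group: the rows 3, 4, 5 give 4, 6, 5, hence
    the subtraction of 4.\<close>
  let ?w = "\<lambda>i::int. if i < 3 then offset i else i + offset i - 4"
  have low: "S r = (if r mod 6 < 3 then 6 * q + g - 1 else 3 * q + 1) + 3 * (r div 6) + ?w (r mod 6)"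
    if "r < 6 * q" for r
    using that int_mod_6_cases[of r] by (auto simp: S_def transversal_column_block row_bound_def; presburger)
  have low_range: "S r \<in> (if r mod 6 < 3 then {6 * q + g - 1..<9 * q + g - 1} else {3 * q + 1..<6 * q + 1})"
      "S' r = S r"
    if "0 \<le> r" "r < 6 * q" for r
  proof -
    have "0 \<le> r div 6" "r div 6 < q" using that by auto
    then show "S r \<in> (if r mod 6 < 3 then {6 * q + g - 1..<9 * q + g - 1} else {3 * q + 1..<6 * q + 1})"
      using that int_mod_6_cases[of r] by (auto simp: low)
    then show "S' r = S r"
      using assms(1-3) by (auto simp: S'_def split: if_splits)
  qed
  have high: "S r = \<tau> (r - 6 * q) + up (r - 6 * q) + 6 * q" "r - 6 * q \<in> {0..<2 * g - 2}"
      "S' r \<in> {9 * q + g - 1..<9 * q + 2 * g - 1} \<union> {6 * q + 1..<6 * q + g - 1}"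
      "S' r = S r \<longleftrightarrow> S' r \<in> {9 * q + g - 1..<9 * q + 2 * g - 1}"
    if "6 * q \<le> r" "r < n" for r
    using \<tau>(1)[of "r - 6 * q"] that assms(1-3)
    by (auto simp: S_def S'_def transversal_column_special row_bound_def)
  fix r r' assume r: "r \<in> {0..<n}" "r' \<in> {0..<n}"
    and "(r + transversal_column q g \<tau> r + row_bound q block_up up r) mod n
      = (r' + transversal_column q g \<tau> r' + row_bound q block_up up r') mod n"
  then have "S' r mod n = S' r' mod n"
    by (simp add: S_def S'_def)
  moreover have "3 * q + 1 \<le> S' x \<and> S' x < 3 * q + 1 + n" if "x \<in> {0..<n}" for x
    using low_range[of x] high(3)[of x] that assms(1-3) by (cases "x < 6 * q") (auto split: if_splits)
  ultimately have eq: "S' r = S' r'"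
    using r eq_if_mod_eq by blast
  show "r = r'"
  proof (cases "r < 6 * q")
    case True
    have "r' < 6 * q"
      by (rule ccontr) (use True low_range[of r] high(3)[of r'] eq r assms(1-3) in \<open>auto split: if_splits\<close>)
    have eqS: "S r = S r'"
      using low_range(2)[of r] low_range(2)[of r'] True \<open>r' < 6 * q\<close> eq r by simp
    have third: "r mod 6 < 3 \<longleftrightarrow> r' mod 6 < 3"
      using low_range(1)[of r] low_range(1)[of r'] True \<open>r' < 6 * q\<close> eqS r assms(1,2) by (auto split: if_splits)
    have "3 * (r div 6) + ?w (r mod 6) = 3 * (r' div 6) + ?w (r' mod 6)"
      using eqS third True \<open>r' < 6 * q\<close> by (simp only: low)
    then have "r div 6 = r' div 6 \<and> ?w (r mod 6) = ?w (r' mod 6)"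
      by (rule div_3_unique) (use int_mod_6_cases[of r] int_mod_6_cases[of r'] in auto)
    moreover from this third have "r mod 6 = r' mod 6"
      using int_mod_6_cases[of r] int_mod_6_cases[of r'] by auto
    ultimately show ?thesis
      by (metis div_mult_mod_eq)
  next
    case False
    have r': "6 * q \<le> r'"
      by (rule ccontr) (use False low_range[of r'] high(3)[of r] eq r assms(1-3) in \<open>auto split: if_splits\<close>)
    have "S r = S r'"
      using high(4)[of r] high(4)[of r'] False r' r eq by (auto simp: S'_def split: if_splits)
    then have "\<tau> (r - 6 * q) + up (r - 6 * q) = \<tau> (r' - 6 * q) + up (r' - 6 * q)"
      using False r' high(1)[of r] high(1)[of r'] r by simp
    then have "r - 6 * q = r' - 6 * q"
      by (rule inj_onD[OF \<tau>(2)]) (use False r' r assms(3) in auto)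
    then show ?thesis by simp
  qed
qed

section \<open>Reduction to the special rows\<close>

text \<open>Since \<open>n div 2 = 3 * q + g - 1\<close> and the blocks contribute
  \<open>3 * q\<close> to the maxima and \<open>- 3 * q\<close> to the minima, the special rows must
  supply exactly \<open>g - 1\<close> and more than \<open>1 - g\<close>. Row 0 of each block has a
  unique maximum and yields one forced entry, which accounts for the \<open>nat q\<close>.\<close>

lemma forced_entries_from_special_rows:
  assumes q: "0 \<le> q" and g: "6 \<le> g" and n: "n = 6 * q + e" and e: "e = 2 * g - 2"
    and \<sigma>_col: "\<And>k x. k \<in> {0..<e} \<Longrightarrow> \<sigma> k x \<in> {0..<e}" "\<And>x. inj_on (\<lambda>k. \<sigma> k x) {0..<e}"
    and \<sigma>_row: "\<And>k. k \<in> {0..<e} \<Longrightarrow> inj_on (\<lambda>x. (x + \<sigma> k x) mod n) {- (3 * q)..<n - 3 * q}"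
    and bound: "\<And>k x. k \<in> {0..<e} \<Longrightarrow> lo k \<le> \<sigma> k x \<and> \<sigma> k x \<le> up k"
    and small: "\<And>k. k \<in> {0..<e} \<Longrightarrow> k - 4 \<le> lo k \<and> up k \<le> k + 4"
    and sum_up: "(\<Sum>k\<in>{0..<e}. up k - k) = g - 1"
    and sum_lo: "1 - g < (\<Sum>k\<in>{0..<e}. lo k - k)"
    and \<tau>_max: "\<And>k. k \<in> {0..<e} \<Longrightarrow> \<sigma> k (\<tau> k - 3 * q) = up k"
    and \<tau>_col: "\<And>k. k \<in> {0..<e} \<Longrightarrow> \<tau> k \<in> {3 * q..<3 * q + g} \<union> {6 * q + g..<n}"
      "inj_on \<tau> {0..<e}"
    and \<tau>_sym: "\<And>k. k \<in> {0..<e} \<Longrightarrow> \<tau> k + up k \<in> {3 * q + g - 1..<3 * q + 2 * g - 1} \<union> {n + 1..<n + g - 1}"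
      "inj_on (\<lambda>k. \<tau> k + up k) {0..<e}"
    and K: "K \<subseteq> {0..<e}" "\<And>k x. k \<in> K \<Longrightarrow> \<sigma> k x = up k \<Longrightarrow> x = \<tau> k - 3 * q"
  shows "\<exists>L. latin_square n L \<and> (\<exists>T. transversal n L T) \<and>
           (\<exists>E. E \<subseteq> L \<and> card E = nat q + card K \<and>
                (\<forall>D. suitable_diagonal n L D \<longrightarrow> E \<subseteq> D))"
proof -
  let ?d = "displacement q g \<sigma>" and ?t = "transversal_column q g \<tau>"
  let ?up = "row_bound q block_up up" and ?lo = "row_bound q block_lo lo"
  let ?A = "(\<lambda>j. 6 * j) ` {0..<q}" and ?S = "(\<lambda>k. 6 * q + k) ` K"
  have "even n" "10 \<le> n" and n': "n = 6 * q + (2 * g - 2)" "n div 2 = 3 * q + g - 1"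
    using q g n e by auto
  have max: "?d r (?t r) = ?up r" if "r \<in> {0..<n}" for r
    using displacement_transversal_column[of r q e \<sigma> \<tau> up] \<tau>_max that n by blast
  have "finite K"
    using K(1) finite_subset by blast
  have "card (?A \<union> ?S) = card ?A + card ?S"
    using K(1) \<open>finite K\<close> by (intro card_Un_disjoint) auto
  then have card: "card (?A \<union> ?S) = nat q + card K"
    by (simp add: card_image inj_on_def)
  have "\<exists>L. latin_square n L \<and> (\<exists>T. transversal n L T) \<and>
           (\<exists>E. E \<subseteq> L \<and> card E = card (?A \<union> ?S) \<and>
                (\<forall>D. suitable_diagonal n L D \<longrightarrow> E \<subseteq> D))"
  proof (rule shifted_square_forced_entries[where d = ?d and t = ?t and up = ?up and lo = ?lo])
    show "0 < n" "even n" using \<open>10 \<le> n\<close> \<open>even n\<close> by auto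
    show "inj_on (\<lambda>c. (r + c + ?d r c) mod n) {0..<n}" if "r \<in> {0..<n}" for r
      using inj_on_displacement_row[OF \<open>even n\<close> g n'(1) _ that] \<sigma>_row e by blast
    show "inj_on (\<lambda>r. (r + c + ?d r c) mod n) {0..<n}" for c
      by (rule inj_on_displacement_col[OF q _ n]) (use \<sigma>_col g e in auto)
    show "?lo r \<le> ?d r c \<and> ?d r c \<le> ?up r" if "r \<in> {0..<n}" for r c
    proof (cases "r < 6 * q")
      case True
      then show ?thesis
        using int_mod_6_cases[of r] by (auto simp: displacement_def row_bound_def block_def)
    next
      case False
      then show ?thesis
        using bound[of "r - 6 * q"] that n by (auto simp: displacement_def row_bound_def)
    qed
    show "- n < 2 * ?lo r \<and> 2 * ?up r \<le> n" if "r \<in> {0..<n}" for r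
      using small[of "r - 6 * q"] that n \<open>10 \<le> n\<close> by (auto simp: row_bound_def)
    show "(\<Sum>r\<in>{0..<n}. ?up r) = n div 2"
      using q g e n sum_up n'(2) by (simp add: sum_row_bound)
    show "- (n div 2) < (\<Sum>r\<in>{0..<n}. ?lo r)"
      using q g e n sum_lo n'(2) by (simp add: sum_row_bound)
    show "?t r \<in> {0..<n}" if "r \<in> {0..<n}" for r
      using transversal_column_bij(2)[OF q g n'(1)] \<tau>_col that e by blast
    show "inj_on ?t {0..<n}"
      using transversal_column_bij(1)[OF q g n'(1)] \<tau>_col e by blast
    show "?d r (?t r) = ?up r" if "r \<in> {0..<n}" for r
      using max that .
    have "inj_on (\<lambda>r. (r + ?t r + ?up r) mod n) {0..<n}"
      using transversal_column_symbols[OF q g n'(1)] \<tau>_sym e by blast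
    then show "inj_on (\<lambda>r. (r + ?t r + ?d r (?t r)) mod n) {0..<n}"
      \<comment> \<open>Along \<open>?t\<close> the displacement equals the row bound, in terms of
        which the symbols were counted.\<close>
      by (rule inj_on_cong[THEN iffD1, rotated]) (simp only: max)
    show "?A \<union> ?S \<subseteq> {0..<n}"
      using K(1) n q e g by auto
    show "c = ?t r" if r: "r \<in> ?A \<union> ?S" and c: "?d r c = ?up r" for r c
    proof (cases "r \<in> ?A")
      case True
      then show ?thesis
        using c by (auto simp: displacement_def row_bound_def block_def transversal_column_block split: if_splits)
    next
      case False
      then obtain k where k: "k \<in> K" "r = 6 * q + k"
        using r by blast
      then show ?thesis
        using K(1) K(2)[OF k(1), of "c - 3 * q"] c by (auto simp: displacement_def row_bound_def transversal_column_special)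
    qed
  qed
  then show ?thesis
    by (simp only: card)
qed

section \<open>Special rows given by finite tables\<close>

text \<open>A table lists only the few special rows that exchange symbols; the others keep their
  cyclic symbols.\<close>

definition relabel :: "int list \<Rightarrow> int \<Rightarrow> int" where
  "relabel xs k = (if 0 \<le> k \<and> k < int (length xs) then xs ! nat k else k)"

lemma
  assumes "distinct xs" "set xs \<subseteq> {0..<int (length xs)}" "int (length xs) \<le> e"
  shows relabel_range: "k \<in> {0..<e} \<Longrightarrow> relabel xs k \<in> {0..<e}"
    and inj_on_relabel: "inj_on (relabel xs) {0..<e}"
proof -
  have "xs ! nat k \<in> {0..<int (length xs)}" if "0 \<le> k" "k < int (length xs)" for k
    using subsetD[OF assms(2) nth_mem, of "nat k"] that by (simp add: nat_less_iff)
  then have small: "0 \<le> relabel xs k \<and> relabel xs k < int (length xs)" if "0 \<le> k" "k < int (length xs)" for k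
    using that by (simp add: relabel_def)
  show "relabel xs k \<in> {0..<e}" if "k \<in> {0..<e}"
    using small[of k] that assms(3) by (cases "k < int (length xs)") (auto simp: relabel_def)
  show "inj_on (relabel xs) {0..<e}"
  proof (rule inj_onI)
    fix k k' assume k: "k \<in> {0..<e}" "k' \<in> {0..<e}" and eq: "relabel xs k = relabel xs k'"
    show "k = k'"
    proof (cases "k < int (length xs) \<and> k' < int (length xs)")
      case True
      then have "nat k = nat k'"
        using eq k assms(1) by (simp add: relabel_def nth_eq_iff_index_eq nat_less_iff)
      then show ?thesis
        using k by (simp add: eq_nat_nat_iff)
    next
      case False
      then show ?thesis
        using small[of k] small[of k'] k eq by (auto simp: relabel_def split: if_splits)
    qed
  qed
qed

lemma sum_relabel:
  assumes "int (length xs) \<le> e"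
  shows "(\<Sum>k\<in>{0..<e}. relabel xs k - k) = sum_list xs - (\<Sum>i<length xs. int i)"
proof -
  have "(\<Sum>k\<in>{0..<e}. relabel xs k - k) = (\<Sum>k\<in>{0..<int (length xs)}. relabel xs k - k)"
    by (rule sum.mono_neutral_right) (use assms in \<open>auto simp: relabel_def\<close>)
  also have "\<dots> = (\<Sum>i<length xs. xs ! i - int i)"
    by (rule sum.reindex_bij_witness[of _ int nat]) (auto simp: relabel_def)
  also have "\<dots> = sum_list xs - (\<Sum>i<length xs. int i)"
    by (simp add: sum_subtractf sum_list_sum_nth atLeast0LessThan)
  finally show ?thesis .
qed

text \<open>Away from a short defect the tables are periodic in \<open>x\<close>. The defect makes the maximum
  entry of one or two rows unique, and makes the row maxima exceed \<open>k\<close> by a total of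
  \<open>g - 1\<close> while the row minima fall short of it by less than that, which excludes the
  diagonals of sum \<open>- n div 2\<close>. The tables and the transversals through them were found by
  a SAT search.\<close>

definition table10 :: "int \<Rightarrow> int list" where
  "table10 x =
    (if x = 2 then [3, 1, 2, 0] else if x = 3 then [0, 3, 2, 1] else if x = 4 then [0, 1, 2, 3]
     else if x mod 3 = 0 \<and> x < 2 \<or> x mod 3 = 1 \<and> 4 < x then [1, 0, 2, 3] else [1, 3, 2, 0])"

definition table12 :: "int \<Rightarrow> int list" where
  "table12 x =
    (if x = 3 then [0, 3, 1, 2] else if x = 4 then [1, 0, 3, 2] else if x = 5 then [3, 0, 1, 2]
     else if x = 6 then [0, 1, 3, 2] else if x = 7 then [0, 2, 1, 3]
     else if even x then [2, 0, 3, 1] else [0, 2, 1, 3])"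

definition table14 :: "int \<Rightarrow> int list" where
  "table14 x =
    (if x = 5 then [2, 0, 1, 3, 4] else if x = 6 then [0, 1, 3, 4, 2]
     else if x = 7 then [1, 3, 0, 2, 4] else if x = 8 then [1, 4, 0, 3, 2]
     else if even x then [1, 4, 0, 2, 3] else [1, 0, 2, 4, 3])"

text \<open>Listed rows take values in \<open>{0..4}\<close>, so only distances up to 4 can produce
  a collision; the other rows are translations.\<close>

lemma inj_on_relabel_row:
  assumes tab: "\<And>x. length (tab x) = m" "\<And>x. set (tab x) \<subseteq> {0..4}"
    and n: "int m \<le> n" "5 \<le> n" "k \<in> {0..<n}"
    and step: "\<And>i x d. i < m \<Longrightarrow> d \<in> {1..4} \<Longrightarrow> tab x ! i \<noteq> tab (x + d) ! i + d"
    and wrap: "\<And>i j d. i < m \<Longrightarrow> d \<in> {1..4} \<Longrightarrow> j \<in> {0..<d} \<Longrightarrow>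
      tab (l + n + j - d) ! i \<noteq> tab (l + j) ! i + d"
  shows "inj_on (\<lambda>x. (x + relabel (tab x) k) mod n) {l..<l + n}"
proof (cases "k < int m")
  case True
  define i where "i = nat k"
  have i: "i < m" and relabel: "relabel (tab x) k = tab x ! i" for x
    using True n(3) tab(1) by (auto simp: i_def relabel_def)
  have "0 \<le> tab x ! i \<and> tab x ! i \<le> 4" for x
    using subsetD[OF tab(2) nth_mem, of i x] i tab(1) by simp
  then show ?thesis
    unfolding relabel using n(2) by (intro inj_on_add_mod[of 4] step wrap i) auto
next
  case False
  then have "relabel (tab x) k = k" for x
    using tab(1) by (simp add: relabel_def)
  then show ?thesis
    using n(3) inj_on_add_mod[of k n "\<lambda>_. k" l] by simp
qed

text \<open>The transversal meets row \<open>6 * q + k\<close> in the column coded by \<open>us ! k\<close>: codes below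
  \<open>g\<close> stand for the second and the others for the fourth of the four column intervals.\<close>

lemma forced_entries_from_table:
  assumes q: "0 \<le> q" and g: "6 \<le> g" and n: "n = 6 * q + e" and e: "e = 2 * g - 2"
    and tab: "\<And>x. length (tab x) = m" "\<And>x. distinct (tab x)" "\<And>x. set (tab x) \<subseteq> {0..<int m}"
    and "m \<le> 5"
    and step: "\<And>i x d. i < m \<Longrightarrow> d \<in> {1..4} \<Longrightarrow> tab x ! i \<noteq> tab (x + d) ! i + d"
    and wrap: "\<And>i j d. i < m \<Longrightarrow> d \<in> {1..4} \<Longrightarrow> j \<in> {0..<d} \<Longrightarrow>
      tab (- (3 * q) + n + j - d) ! i \<noteq> tab (- (3 * q) + j) ! i + d"
    and lo: "length lo = m" "set lo \<subseteq> {0..4}" "\<And>i x. i < m \<Longrightarrow> lo ! i \<le> tab x ! i"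
      "1 - g < sum_list lo - (\<Sum>i<m. int i)"
    and up: "length up = m" "set up \<subseteq> {0..4}" "\<And>i x. i < m \<Longrightarrow> tab x ! i \<le> up ! i"
      "sum_list up - (\<Sum>i<m. int i) = g - 1"
    and us: "int (length us) = e" "distinct us" "set us \<subseteq> {0..<e}"
      "\<And>i. i < m \<Longrightarrow> tab (if us ! i < g then us ! i else 3 * q + us ! i) ! i = up ! i"
    and ws: "ws = map2 (+) us (up @ [int m..e - 1])" "distinct ws"
      "list_all2 (\<lambda>u w. w \<in> (if u < g then {g - 1..<2 * g - 1} else {2 * g - 1..<3 * g - 3})) us ws"
    and K: "K \<subseteq> {..<m}" "\<And>i x. i \<in> K \<Longrightarrow> tab x ! i = up ! i \<Longrightarrow> x = us ! i \<and> x < g"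
  shows "\<exists>L. latin_square n L \<and> (\<exists>T. transversal n L T) \<and>
           (\<exists>E. E \<subseteq> L \<and> card E = nat q + card K \<and>
                (\<forall>D. suitable_diagonal n L D \<longrightarrow> E \<subseteq> D))"
proof -
  define \<tau> where "\<tau> k = (if us ! nat k < g then 3 * q else 6 * q) + us ! nat k" for k
  have me: "int m \<le> e" using g e \<open>m \<le> 5\<close> by simp
  have nth: "\<exists>i<m. k = int i" if "0 \<le> k" "k < int m" for k
    using that by (intro exI[of _ "nat k"]) auto
  have relabel_small: "relabel xs k = xs ! i" if "length xs = m" "i < m" "k = int i" for xs k i
    using that by (simp add: relabel_def)
  have relabel_large: "relabel xs k = k" if "length xs = m" "int m \<le> k" for xs k
    using that by (simp add: relabel_def)
  have len: "length ws = length us"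
    using us(1) up(1) me by (simp add: ws(1))
  have u: "us ! nat k \<in> {0..<e}" if "k \<in> {0..<e}" for k
    using subsetD[OF us(3) nth_mem, of "nat k"] us(1) that by (simp add: nat_less_iff)
  have w: "ws ! nat k = us ! nat k + relabel up k"
    "ws ! nat k \<in> (if us ! nat k < g then {g - 1..<2 * g - 1} else {2 * g - 1..<3 * g - 3})"
    if "k \<in> {0..<e}" for k
  proof -
    have k: "nat k < length us"
      using us(1) that by (simp add: nat_less_iff)
    have "(up @ [int m..e - 1]) ! nat k = relabel up k"
      using up(1) that by (auto simp: relabel_def nth_append nth_upto nat_less_iff of_nat_diff)
    then show "ws ! nat k = us ! nat k + relabel up k"
      using k us(1) up(1) me by (simp add: ws(1))
    show "ws ! nat k \<in> (if us ! nat k < g then {g - 1..<2 * g - 1} else {2 * g - 1..<3 * g - 3})"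
      using list_all2_nthD[OF ws(3) k] .
  qed
  \<comment> \<open>\<open>ws\<close> codes the symbols, less the row number \<open>6 * q\<close>,
    as \<open>us\<close> codes the columns: the same multiple of \<open>q\<close> is added, so the
    ranges of \<open>ws\<close> become the required symbol intervals.\<close>
  have sym: "\<tau> k + relabel up k = (if us ! nat k < g then 3 * q else 6 * q) + ws ! nat k"
    if "k \<in> {0..<e}" for k
    using w(1)[OF that] by (simp add: \<tau>_def)
  have inj: "k = k'"
    if "xs ! nat k = xs ! nat k'" "distinct xs" "length xs = length us" "k \<in> {0..<e}" "k' \<in> {0..<e}"
    for xs :: "int list" and k k'
  proof -
    have "nat k = nat k'"
      using that us(1) nth_eq_iff_index_eq[of xs "nat k" "nat k'"] by (simp add: nat_less_iff)
    with that show ?thesis by (simp add: eq_nat_nat_iff)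
  qed
  have "\<exists>L. latin_square n L \<and> (\<exists>T. transversal n L T) \<and>
           (\<exists>E. E \<subseteq> L \<and> card E = nat q + card (int ` K) \<and>
                (\<forall>D. suitable_diagonal n L D \<longrightarrow> E \<subseteq> D))"
  proof (rule forced_entries_from_special_rows[where \<tau> = \<tau> and \<sigma> = "\<lambda>k x. relabel (tab x) k"
        and lo = "relabel lo" and up = "relabel up", OF q g n e])
    show "relabel (tab x) k \<in> {0..<e}" if "k \<in> {0..<e}" for k x
      by (rule relabel_range) (use tab me that in auto)
    show "inj_on (\<lambda>k. relabel (tab x) k) {0..<e}" for x
      by (rule inj_on_relabel) (use tab me in auto)
    have "inj_on (\<lambda>x. (x + relabel (tab x) k) mod n) {- (3 * q)..<- (3 * q) + n}" if "k \<in> {0..<e}" for k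
    proof (rule inj_on_relabel_row[OF tab(1) _ _ _ _ step wrap])
      show "set (tab x) \<subseteq> {0..4}" for x
        using tab(3)[of x] \<open>m \<le> 5\<close> by auto
      show "int m \<le> n" "5 \<le> n" "k \<in> {0..<n}"
        using me q g e n that by auto
    qed
    then show "inj_on (\<lambda>x. (x + relabel (tab x) k) mod n) {- (3 * q)..<n - 3 * q}" if "k \<in> {0..<e}" for k
      using that by simp
    show "relabel lo k \<le> relabel (tab x) k \<and> relabel (tab x) k \<le> relabel up k" if "k \<in> {0..<e}" for k x
      using nth[of k] lo up tab(1) that by (cases "k < int m") (auto simp: relabel_small relabel_large)
    show "k - 4 \<le> relabel lo k \<and> relabel up k \<le> k + 4" if "k \<in> {0..<e}" for k
    proof (cases "k < int m")
      case True
      then obtain i where i: "i < m" "k = int i"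
        using nth[of k] \<open>k \<in> {0..<e}\<close> by auto
      have "lo ! i \<in> {0..4}" "up ! i \<in> {0..4}"
        by (rule subsetD[OF lo(2) nth_mem] subsetD[OF up(2) nth_mem], use i lo(1) up(1) in simp)+
      then show ?thesis
        using i lo(1) up(1) \<open>m \<le> 5\<close> by (simp add: relabel_small)
    next
      case False
      then show ?thesis using lo(1) up(1) by (simp add: relabel_large)
    qed
    show "(\<Sum>k\<in>{0..<e}. relabel up k - k) = g - 1" "1 - g < (\<Sum>k\<in>{0..<e}. relabel lo k - k)"
      using up(1,4) lo(1,4) me by (simp_all add: sum_relabel)
    show "relabel (tab (\<tau> k - 3 * q)) k = relabel up k" if "k \<in> {0..<e}" for k
    proof (cases "k < int m")
      case True
      then obtain i where i: "i < m" "k = int i"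
        using nth[of k] \<open>k \<in> {0..<e}\<close> by auto
      then have "\<tau> k - 3 * q = (if us ! i < g then us ! i else 3 * q + us ! i)"
        by (simp add: \<tau>_def)
      with us(4)[OF i(1)] show ?thesis
        using i tab(1) up(1) by (simp only: relabel_small)
    next
      case False
      then show ?thesis using tab(1) up(1) by (simp add: relabel_large)
    qed
    show "\<tau> k \<in> {3 * q..<3 * q + g} \<union> {6 * q + g..<n}" if "k \<in> {0..<e}" for k
      using u[OF that] n by (auto simp: \<tau>_def)
    show "\<tau> k + relabel up k \<in> {3 * q + g - 1..<3 * q + 2 * g - 1} \<union> {n + 1..<n + g - 1}"
      if "k \<in> {0..<e}" for k
      unfolding sym[OF that] using w(2)[OF that] n e by (auto split: if_splits)
    show "inj_on \<tau> {0..<e}"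
    proof (rule inj_onI)
      fix k k' assume k: "k \<in> {0..<e}" "k' \<in> {0..<e}" and "\<tau> k = \<tau> k'"
      then have "us ! nat k = us ! nat k'"
        using u[OF k(1)] u[OF k(2)] q by (auto simp: \<tau>_def split: if_splits)
      then show "k = k'"
        by (rule inj[OF _ us(2) refl k])
    qed
    show "inj_on (\<lambda>k. \<tau> k + relabel up k) {0..<e}"
    proof (rule inj_onI)
      fix k k' assume k: "k \<in> {0..<e}" "k' \<in> {0..<e}" and "\<tau> k + relabel up k = \<tau> k' + relabel up k'"
      then have "ws ! nat k = ws ! nat k'"
        unfolding sym[OF k(1)] sym[OF k(2)] using w(2)[OF k(1)] w(2)[OF k(2)] q by (auto split: if_splits)
      then show "k = k'"
        by (rule inj[OF _ ws(2) len k])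
    qed
    show "int ` K \<subseteq> {0..<e}"
      using K(1) me by auto
    show "x = \<tau> k - 3 * q" if "k \<in> int ` K" "relabel (tab x) k = relabel up k" for k x
    proof -
      from that(1) obtain i where i: "i \<in> K" "k = int i" by blast
      moreover have "i < m" using i K(1) by blast
      ultimately have "x = us ! i \<and> x < g"
        using \<open>relabel (tab x) k = relabel up k\<close> tab(1) up(1) i K(2)[OF i(1), of x] by (simp add: relabel_small)
      with i show ?thesis by (simp add: \<tau>_def)
    qed
  qed
  then show ?thesis
    by (simp add: card_image)
qed

section \<open>The three tables and the residues of \<open>n\<close> modulo 6\<close>

text \<open>The defect at \<open>x = 2, 3, 4\<close> moves the phase of the period-3 pattern from 0
  to 1, which makes it close up across the end of the window because \<open>6 * q + 10\<close> is 1
  modulo 3.\<close>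

lemma table10_row:
  assumes "i < 4" "d \<in> {1..4}"
  shows "table10 x ! i \<noteq> table10 (x + d) ! i + d"
    and "0 \<le> q \<Longrightarrow> j \<in> {0..<d} \<Longrightarrow>
      table10 (- (3 * q) + (6 * q + 10) + j - d) ! i \<noteq> table10 (- (3 * q) + j) ! i + d"
proof -
  have i: "i \<in> {0, 1, 2, 3}" and d: "d \<in> {1, 2, 3, 4}" using assms by auto
  \<comment> \<open>Fixing the residue of \<open>x\<close> modulo 3 makes every table lookup a
    matter of linear comparisons.\<close>
  obtain a r where x: "x = 3 * a + r" and r: "r \<in> {0, 1, 2}"
    using mult_div_mod_eq[of 3 x] pos_mod_bound[of 3 x] pos_mod_sign[of 3 x] that[of "x div 3" "x mod 3"] by force
  show "table10 x ! i \<noteq> table10 (x + d) ! i + d"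
    using i d r unfolding x by (elim insertE emptyE) (simp_all add: table10_def)
  assume "0 \<le> q" "j \<in> {0..<d}"
  then have j: "j \<in> {0, 1, 2, 3}" "j < d" using d by auto
  have "(c - 3 * q) mod 3 = c mod 3" for c
    by presburger
  with i d j \<open>0 \<le> q\<close> show
    "table10 (- (3 * q) + (6 * q + 10) + j - d) ! i \<noteq> table10 (- (3 * q) + j) ! i + d"
    by (elim insertE emptyE) (simp_all add: table10_def)
qed

text \<open>The pattern has period 2 with the same phase on both sides of the defect, in accordance
  with \<open>6 * q + 12\<close> being even.\<close>

lemma table12_row:
  assumes "i < 4" "d \<in> {1..4}"
  shows "table12 x ! i \<noteq> table12 (x + d) ! i + d"
    and "0 \<le> q \<Longrightarrow> j \<in> {0..<d} \<Longrightarrow>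
      table12 (- (3 * q) + (6 * q + 12) + j - d) ! i \<noteq> table12 (- (3 * q) + j) ! i + d"
proof -
  have i: "i \<in> {0, 1, 2, 3}" and d: "d \<in> {1, 2, 3, 4}" using assms by auto
  show "table12 x ! i \<noteq> table12 (x + d) ! i + d"
    using i d by (elim insertE emptyE; simp add: table12_def; presburger)
  assume "0 \<le> q" "j \<in> {0..<d}"
  then have "j \<in> {0, 1, 2, 3}" "j < d" using d by auto
  with i d \<open>0 \<le> q\<close> show
    "table12 (- (3 * q) + (6 * q + 12) + j - d) ! i \<noteq> table12 (- (3 * q) + j) ! i + d"
    by (elim insertE emptyE; simp add: table12_def; presburger)
qed

lemma table14_row:
  assumes "i < 5" "d \<in> {1..4}"
  shows "table14 x ! i \<noteq> table14 (x + d) ! i + d"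
    and "0 \<le> q \<Longrightarrow> j \<in> {0..<d} \<Longrightarrow>
      table14 (- (3 * q) + (6 * q + 14) + j - d) ! i \<noteq> table14 (- (3 * q) + j) ! i + d"
proof -
  have i: "i \<in> {0, 1, 2, 3, 4}" and d: "d \<in> {1, 2, 3, 4}" using assms by auto
  show "table14 x ! i \<noteq> table14 (x + d) ! i + d"
    using i d by (elim insertE emptyE; simp add: table14_def; presburger)
  assume "0 \<le> q" "j \<in> {0..<d}"
  then have "j \<in> {0, 1, 2, 3}" "j < d" using d by auto
  with i d \<open>0 \<le> q\<close> show
    "table14 (- (3 * q) + (6 * q + 14) + j - d) ! i \<noteq> table14 (- (3 * q) + j) ! i + d"
    by (elim insertE emptyE; simp add: table14_def; presburger)
qed

text \<open>The maxima contribute 11 - 6 = 5 = \<open>g - 1\<close>, the minima 2 - 6 = -4, just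
  above the excluded -5. Row 0 reaches 3 only at \<open>x = 2\<close>.\<close>

lemma forced_entries_10:
  assumes q: "0 \<le> q" and n: "n = 6 * q + 10"
  shows "\<exists>L. latin_square n L \<and> (\<exists>T. transversal n L T) \<and>
           (\<exists>E. E \<subseteq> L \<and> card E = nat q + 1 \<and>
                (\<forall>D. suitable_diagonal n L D \<longrightarrow> E \<subseteq> D))"
proof -
  let ?lo = "[0, 0, 2, 0] :: int list" and ?up = "[3, 3, 2, 3] :: int list"
  let ?us = "[2, 3, 9, 4, 5, 8, 6, 7, 0, 1] :: int list"
  have "\<exists>L. latin_square n L \<and> (\<exists>T. transversal n L T) \<and>
           (\<exists>E. E \<subseteq> L \<and> card E = nat q + card {0::nat} \<and>
                (\<forall>D. suitable_diagonal n L D \<longrightarrow> E \<subseteq> D))"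
  \<comment> \<open>The closing \<open>refl\<close> solves the equation for \<open>ws\<close>, so
    the symbol codes are computed from \<open>us\<close> and \<open>up\<close>.\<close>
  proof (rule forced_entries_from_table[where g = 6 and m = 4 and tab = table10 and us = ?us
        and lo = ?lo and up = ?up, OF q _ n _ _ _ _ _ table10_row(1) _ _ _ _ _ _ _ _ _ _ _ _ _ refl])
    show "table10 (- (3 * q) + n + j - d) ! i \<noteq> table10 (- (3 * q) + j) ! i + d"
      if "i < 4" "d \<in> {1..4}" "j \<in> {0..<d}" for i j d
      unfolding n by (rule table10_row(2)[OF that(1,2) q that(3)])
    fix i :: nat and x
    show "x = ?us ! i \<and> x < 6" if "i \<in> {0}" "table10 x ! i = ?up ! i"
      using that by (auto simp: table10_def split: if_splits)
    assume "i < 4"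
    then have i: "i \<in> {0, 1, 2, 3}" by auto
    show "?lo ! i \<le> table10 x ! i" "table10 x ! i \<le> ?up ! i"
      using i by (auto simp: table10_def)
    show "table10 (if ?us ! i < 6 then ?us ! i else 3 * q + ?us ! i) ! i = ?up ! i"
      using i q by (elim insertE emptyE) (auto simp: table10_def)
  qed (use q in \<open>auto simp: table10_def upto.simps numeral_eq_Suc\<close>)
  then show ?thesis by simp
qed

text \<open>With \<open>g = 7\<close> the maxima contribute 12 - 6 = 6 and the minima 2 - 6 = -4.
  Row 0 reaches 3 only at \<open>x = 5\<close>, row 1 only at \<open>x = 3\<close>.\<close>

lemma forced_entries_12:
  assumes q: "0 \<le> q" and n: "n = 6 * q + 12"
  shows "\<exists>L. latin_square n L \<and> (\<exists>T. transversal n L T) \<and>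
           (\<exists>E. E \<subseteq> L \<and> card E = nat q + 2 \<and>
                (\<forall>D. suitable_diagonal n L D \<longrightarrow> E \<subseteq> D))"
proof -
  \<comment> \<open>Rows 2 and 3 attain their maximum on columns of opposite parity.\<close>
  obtain a b :: int where ab: "even q \<and> a = 10 \<and> b = 11 \<or> odd q \<and> a = 11 \<and> b = 10"
    by (cases "even q") auto
  let ?lo = "[0, 0, 1, 1] :: int list" and ?up = "[3, 3, 3, 3] :: int list"
  let ?us = "[5, 3, a, b, 6, 4, 9, 0, 8, 2, 7, 1] :: int list"
  have "\<exists>L. latin_square n L \<and> (\<exists>T. transversal n L T) \<and>
           (\<exists>E. E \<subseteq> L \<and> card E = nat q + card {0, 1::nat} \<and>
                (\<forall>D. suitable_diagonal n L D \<longrightarrow> E \<subseteq> D))"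
  proof (rule forced_entries_from_table[where g = 7 and m = 4 and tab = table12 and us = ?us
        and lo = ?lo and up = ?up, OF q _ n _ _ _ _ _ table12_row(1) _ _ _ _ _ _ _ _ _ _ _ _ _ refl])
    show "table12 (- (3 * q) + n + j - d) ! i \<noteq> table12 (- (3 * q) + j) ! i + d"
      if "i < 4" "d \<in> {1..4}" "j \<in> {0..<d}" for i j d
      unfolding n by (rule table12_row(2)[OF that(1,2) q that(3)])
    fix i :: nat and x
    show "x = ?us ! i \<and> x < 7" if "i \<in> {0, 1}" "table12 x ! i = ?up ! i"
      using that by (auto simp: table12_def split: if_splits)
    assume "i < 4"
    then have i: "i \<in> {0, 1, 2, 3}" by auto
    show "?lo ! i \<le> table12 x ! i" "table12 x ! i \<le> ?up ! i"
      using i by (auto simp: table12_def)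
    show "table12 (if ?us ! i < 7 then ?us ! i else 3 * q + ?us ! i) ! i = ?up ! i"
      using i q ab by (elim insertE emptyE) (auto simp: table12_def)
  qed (use ab in \<open>auto simp: table12_def upto.simps numeral_eq_Suc\<close>)
  then show ?thesis by simp
qed

text \<open>With \<open>g = 8\<close> the maxima contribute 17 - 10 = 7 and the minima 4 - 10 = -6.
  Row 0 reaches 2 only at \<open>x = 5\<close>, row 2 reaches 3 only at
  \<open>x = 6\<close>.\<close>

lemma forced_entries_14:
  assumes q: "0 \<le> q" and n: "n = 6 * q + 14"
  shows "\<exists>L. latin_square n L \<and> (\<exists>T. transversal n L T) \<and>
           (\<exists>E. E \<subseteq> L \<and> card E = nat q + 2 \<and>
                (\<forall>D. suitable_diagonal n L D \<longrightarrow> E \<subseteq> D))"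
proof -
  \<comment> \<open>Rows 1 and 3 attain their maximum on columns of opposite parity.\<close>
  obtain a b :: int where ab: "even q \<and> a = 12 \<and> b = 13 \<or> odd q \<and> a = 13 \<and> b = 12"
    by (cases "even q") auto
  let ?lo = "[0, 0, 0, 2, 2] :: int list" and ?up = "[2, 4, 3, 4, 4] :: int list"
  let ?us = "[5, a, 6, b, 7, 10, 4, 11, 0, 3, 9, 2, 8, 1] :: int list"
  have "\<exists>L. latin_square n L \<and> (\<exists>T. transversal n L T) \<and>
           (\<exists>E. E \<subseteq> L \<and> card E = nat q + card {0, 2::nat} \<and>
                (\<forall>D. suitable_diagonal n L D \<longrightarrow> E \<subseteq> D))"
  proof (rule forced_entries_from_table[where g = 8 and m = 5 and tab = table14 and us = ?us
        and lo = ?lo and up = ?up, OF q _ n _ _ _ _ _ table14_row(1) _ _ _ _ _ _ _ _ _ _ _ _ _ refl])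
    show "table14 (- (3 * q) + n + j - d) ! i \<noteq> table14 (- (3 * q) + j) ! i + d"
      if "i < 5" "d \<in> {1..4}" "j \<in> {0..<d}" for i j d
      unfolding n by (rule table14_row(2)[OF that(1,2) q that(3)])
    fix i :: nat and x
    show "x = ?us ! i \<and> x < 8" if "i \<in> {0, 2}" "table14 x ! i = ?up ! i"
      using that by (auto simp: table14_def split: if_splits)
    assume "i < 5"
    then have i: "i \<in> {0, 1, 2, 3, 4}" by auto
    show "?lo ! i \<le> table14 x ! i" "table14 x ! i \<le> ?up ! i"
      using i by (auto simp: table14_def)
    show "table14 (if ?us ! i < 8 then ?us ! i else 3 * q + ?us ! i) ! i = ?up ! i"
      using i q ab by (elim insertE emptyE) (auto simp: table14_def)
  qed (use ab in \<open>auto simp: table14_def upto.simps numeral_eq_Suc\<close>)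
  then show ?thesis by simp
qed

text \<open>According to the residue of \<open>n\<close> modulo 6, there are 12, 14 or 10 special
  rows with 2, 2 or 1 forced entries; together with one entry for each of the remaining blocks this
  gives \<open>n div 6\<close>.\<close>

theorem theorem6:
  fixes n :: int
  assumes "even n" and "n \<ge> 10"
  shows "\<exists>L. latin_square n L \<and> (\<exists>T. transversal n L T) \<and>
           (\<exists>E. E \<subseteq> L \<and> card E = nat (n div 6) \<and>
                (\<forall>D. suitable_diagonal n L D \<longrightarrow> E \<subseteq> D))"
proof -
  let ?k = "n div 6"
  have "n mod 6 = 0 \<or> n mod 6 = 2 \<or> n mod 6 = 4"
    using \<open>even n\<close> by presburger
  then consider "n mod 6 = 0" | "n mod 6 = 2" | "n mod 6 = 4"
    by blast
  then show ?thesis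
  proof cases
    case 1
    have "0 \<le> ?k - 2" "n = 6 * (?k - 2) + 12"
      by (use 1 \<open>n \<ge> 10\<close> in presburger)+
    moreover from this(1) have "nat (?k - 2) + 2 = nat ?k" by linarith
    ultimately show ?thesis
      using forced_entries_12 by metis
  next
    case 2
    have "0 \<le> ?k - 2" "n = 6 * (?k - 2) + 14"
      by (use 2 \<open>n \<ge> 10\<close> in presburger)+
    moreover from this(1) have "nat (?k - 2) + 2 = nat ?k" by linarith
    ultimately show ?thesis
      using forced_entries_14 by metis
  next
    case 3
    have "0 \<le> ?k - 1" "n = 6 * (?k - 1) + 10"
      by (use 3 \<open>n \<ge> 10\<close> in presburger)+
    moreover from this(1) have "nat (?k - 1) + 1 = nat ?k" by linarith
    ultimately show ?thesis
      using forced_entries_10 by metis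
  qed
qed

end
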